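(* Let $n\ge 2$ be an even integer, let $x_1,\dots,x_{n+1}\in\mathbb{R}$ be distinct and let $y_1,\dots,y_{n+2}\in\mathbb{R}$ be distinct. Put $$\mathcal{A}^e_n=\{(x_{2i},y_{2j}) : 1\le i\le \tfrac n2,\ 1\le j\le \tfrac n2+1\},\quad a(x)=\prod_{i=0}^{n/2}(x-x_{2i+1}),\quad b(y)=\prod_{j=0}^{n/2}(y-y_{2j+1}),$$ $$\mathcal{T}^e_{n/2}=\{a(x)x^\alpha y^\beta : \alpha,\beta\ge 0,\ \alpha+\beta\le \tfrac n2-1\}\cup\{b(y)x^\alpha y^\beta : \alpha,\beta\ge 0,\ \alpha+\beta\le \tfrac n2-1\}.$$ Let $\mathcal{X}=\{x_{2i} : 1\le i\le \frac n2\}$ and $\mathcal{Y}=\{y_{2j} : 1\le j\le \frac n2+1\}$, and let $P\in\mathbb{R}^{\frac n2\times(\frac n2+1)}[x]$, $Q\in\mathbb{R}^{\frac n2\times(\frac n2+1)}[y]$ be the polynomial matrices with entries, for $1\le i\le\frac n2$ and $1\le j\le \frac n2+1$, $$Q_{i,j}(y)=\begin{cases}y^{j-1}, & j\le i,\\ y^{j-i-1}b(y), & j>i,\end{cases}\qquad P_{i,j}(x)=\begin{cases}x^{i-j}a(x), & j\le i,\\ x^{i-1}, & j>i.\end{cases}$$ Then $$\operatorname{vdm}(\mathcal{A}^e_n,\mathcal{T}^e_{n/2})=\pm\left(\prod_{j=1}^{\frac n2+1}\operatorname{vdm}(\mathcal{X},P_{:,j})\right)\cdot\left(\prod_{i=1}^{\frac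 n2}\operatorname{vdm}(\mathcal{Y},Q_{i,:})\right).$$
   Context: For a family of $N$ polynomials $\mathcal{P}=\{f_1,\dots,f_N\}$ and a family of $N$ points $\mathcal{A}=\{\mathbf{a}_1,\dots,\mathbf{a}_N\}$, $\operatorname{vdm}(\mathcal{A},\mathcal{P})=\det\,[f_j(\mathbf{a}_i)]_{i,j=1}^{N}$. For a row or column $R$ of a polynomial matrix, $\operatorname{vdm}(\mathcal{A},R)$ means $\operatorname{vdm}$ with respect to the family of entries of $R$. $P_{:,j}$ is the $j$-th column of $P$ and $Q_{i,:}$ the $i$-th row of $Q$. The orderings of points and of polynomials are arbitrary; they affect $\operatorname{vdm}$ only by a sign, and "$\pm$" means the equality holds up to sign, i.e. the absolute values agree. (The set $\mathcal{A}^e_n$ is the even-index grid of the "Padua-like points" of degree $n$; $a$ and $b$ are the annihilating polynomials, in $x$ and in $y$, of the odd-index grid $\{(x_{2i+1},y_{2j+1}) : 0\le i,j\le \frac n2\}$.) *)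

theory Defs
  imports
    "Jordan_Normal_Form.Determinant"
    "HOL-Computational_Algebra.Polynomial"
    "HOL-Combinatorics.Multiset_Permutations"
begin

text \<open>A family is a list, so that it carries an ordering. The evaluation map is a parameter
  because univariate and bivariate polynomials are evaluated differently.\<close>

definition vdm_wrt :: "('p \<Rightarrow> 'a \<Rightarrow> real) \<Rightarrow> 'a list \<Rightarrow> 'p list \<Rightarrow> real" where
  "vdm_wrt ev as fs = det (mat (length as) (length fs) (\<lambda>(i, j). ev (fs ! j) (as ! i)))"

text \<open>The ring \<open>\<real>[x,y]\<close> is represented as \<open>(\<real>[x])[y]\<close>: the outer polynomial variable is \<open>y\<close>.\<close>

type_synonym bipoly = "real poly poly"

definition in_x :: "real poly \<Rightarrow> bipoly" where
  "in_x p = [:p:]"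

definition in_y :: "real poly \<Rightarrow> bipoly" where
  "in_y q = map_poly (\<lambda>c. [:c:]) q"

definition bieval :: "bipoly \<Rightarrow> real \<times> real \<Rightarrow> real" where
  "bieval f = (\<lambda>(u, v). poly (poly f [:v:]) u)"

lemma bieval_in_x: "bieval (in_x p) (u, v) = poly p u"
  by (simp add: bieval_def in_x_def)

lemma bieval_in_y: "bieval (in_y q) (u, v) = poly q v"
  by (induction q) (auto simp: bieval_def in_y_def map_poly_pCons)

lemma bieval_mult: "bieval (f * g) p = bieval f p * bieval g p"
  by (cases p) (simp add: bieval_def)

definition vdm :: "real list \<Rightarrow> real poly list \<Rightarrow> real" where
  "vdm = vdm_wrt poly"

definition vdm2 :: "(real \<times> real) list \<Rightarrow> bipoly list \<Rightarrow> real" where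
  "vdm2 = vdm_wrt bieval"

definition even_grid :: "nat \<Rightarrow> (nat \<Rightarrow> real) \<Rightarrow> (nat \<Rightarrow> real) \<Rightarrow> (real \<times> real) set" where
  "even_grid n x y =
     {(x (2 * i), y (2 * j)) | i j. 1 \<le> i \<and> i \<le> n div 2 \<and> 1 \<le> j \<and> j \<le> n div 2 + 1}"

text \<open>Applied to the \<open>x\<close>-nodes this is \<open>a(x)\<close>, applied to the \<open>y\<close>-nodes it is \<open>b(y)\<close>.\<close>

definition odd_annihilator :: "nat \<Rightarrow> (nat \<Rightarrow> real) \<Rightarrow> real poly" where
  "odd_annihilator n z = (\<Prod>i = 0..n div 2. [:- z (2 * i + 1), 1:])"

definition even_polys :: "nat \<Rightarrow> real poly \<Rightarrow> real poly \<Rightarrow> bipoly set" where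
  "even_polys n a b =
     {in_x a * in_x (monom 1 \<alpha>) * in_y (monom 1 \<beta>) | \<alpha> \<beta>. \<alpha> + \<beta> \<le> n div 2 - 1} \<union>
     {in_y b * in_x (monom 1 \<alpha>) * in_y (monom 1 \<beta>) | \<alpha> \<beta>. \<alpha> + \<beta> \<le> n div 2 - 1}"

text \<open>Entries carry the usual indices starting from 1, whereas matrix positions start from 0.\<close>

definition Q_entry :: "real poly \<Rightarrow> nat \<Rightarrow> nat \<Rightarrow> real poly" where
  "Q_entry b i j = (if j \<le> i then monom 1 (j - 1) else monom 1 (j - i - 1) * b)"

definition P_entry :: "real poly \<Rightarrow> nat \<Rightarrow> nat \<Rightarrow> real poly" where
  "P_entry a i j = (if j \<le> i then monom 1 (i - j) * a else monom 1 (i - 1))"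

definition Q_mat :: "nat \<Rightarrow> real poly \<Rightarrow> real poly mat" where
  "Q_mat n b = mat (n div 2) (n div 2 + 1) (\<lambda>(i, j). Q_entry b (i + 1) (j + 1))"

definition P_mat :: "nat \<Rightarrow> real poly \<Rightarrow> real poly mat" where
  "P_mat n a = mat (n div 2) (n div 2 + 1) (\<lambda>(i, j). P_entry a (i + 1) (j + 1))"

text \<open>The orderings of the entries of a vector, counted with multiplicity.\<close>

definition entry_orderings :: "'a vec \<Rightarrow> 'a list set" where
  "entry_orderings v = permutations_of_multiset (mset (list_of_vec v))"

end

theory Submission
  imports Defs
begin

text \<open>
  Let \<open>m = n / 2\<close>. The polynomials of the family are the products \<open>P\<^sub>i\<^sub>j(x) Q\<^sub>i\<^sub>j(y)\<close>, one for each
  cell of an \<open>m \<times> (m + 1)\<close> array. If the first factor depended on \<open>i\<close> alone, the matrix would be a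
  product of two block diagonal matrices (up to reordering) and the determinant would factor
  (\<open>abs_vdm_wrt_tensor\<close>). The proof reduces to this case by a triangular change of family.

  On the \<open>m\<close> points of \<open>\<X>\<close> consider, for \<open>i = 1, \<dots>, m\<close>, the spaces spanned by \<open>1, \<dots>, x\<^sup>i\<^sup>-\<^sup>1\<close> and by
  \<open>a(x), \<dots>, a(x) x\<^sup>m\<^sup>-\<^sup>i\<close>; as \<open>i\<close> varies, they form two flags. The dimensions of the two spaces add up
  to \<open>m + 1\<close>, so they share a nonzero function \<open>e\<^sub>i\<close> (\<open>exchange_vectors\<close>). The triangular structure of the family, that is
  \<open>\<alpha> + \<beta> \<le> m - 1\<close>, is what allows \<open>P\<^sub>i\<^sub>j\<close> to be replaced by \<open>e\<^sub>i\<close> throughout: the products with \<open>a\<close>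
  use the second expansion of \<open>e\<^sub>i\<close>, the products with \<open>b\<close> use the first, and both are triangular. The
  price of the replacement is a product of leading coefficients, and exactly the same product appears
  when each column of \<open>P\<close> is replaced by \<open>e\<^sub>1, \<dots>, e\<^sub>m\<close>, so that it cancels
  (\<open>stair_nondegenerate\<close>).

  The cancellation requires that no column of \<open>P\<close> has a vanishing determinant. If one has, then
  two spaces of the flags meet although their dimensions add up to \<open>m\<close> only, and a common function
  multiplies \<open>m + 2\<close> functions of \<open>y\<close> into the span of the family. As there are only \<open>m + 1\<close> points
  in \<open>\<Y>\<close>, the family is dependent and both sides are zero (\<open>stair_degenerate\<close>).

  The argument uses only the shape of the array, so \<open>abs_vdm_wrt_stair\<close> is about arbitrary functions.
  What is particular to the polynomials is that the cells carry pairwise different ones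
  (\<open>inj_on_stair_poly\<close>), so that the family is indexed by the cells.
\<close>

section \<open>Determinants of function families\<close>

lemma vdm_wrt_cong:
  assumes "length as = length as'" "length fs = length fs'"
    and "\<And>i j. i < length as \<Longrightarrow> j < length fs \<Longrightarrow> ev (fs ! j) (as ! i) = ev' (fs' ! j) (as' ! i)"
  shows "vdm_wrt ev as fs = vdm_wrt ev' as' fs'"
  unfolding vdm_wrt_def using assms by (intro arg_cong[where f = det] eq_matI) auto

lemma vdm_wrt_map: "vdm_wrt ev (map h as) (map g fs) = vdm_wrt (\<lambda>f a. ev (g f) (h a)) as fs"
  by (rule vdm_wrt_cong) auto

lemma vdm_wrt_flip:
  assumes "length as = length fs"
  shows "vdm_wrt (\<lambda>a f. ev f a) fs as = vdm_wrt ev as fs"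
proof -
  have "vdm_wrt (\<lambda>a f. ev f a) fs as
      = det (transpose_mat (mat (length as) (length fs) (\<lambda>(i, j). ev (fs ! j) (as ! i))))"
    unfolding vdm_wrt_def by (intro arg_cong[where f = det] eq_matI) auto
  also have "\<dots> = vdm_wrt ev as fs"
    unfolding vdm_wrt_def using assms by (intro det_transpose) auto
  finally show ?thesis .
qed

lemma abs_vdm_wrt_permute_points:
  assumes "mset as = mset as'" "length as = length fs"
  shows "\<bar>vdm_wrt ev as fs\<bar> = \<bar>vdm_wrt ev as' fs\<bar>"
proof -
  let ?n = "length as"
  let ?A = "mat ?n ?n (\<lambda>(i, j). ev (fs ! j) (as' ! i))"
  have len: "length as' = ?n" using assms(1) by (metis size_mset)
  obtain p where p: "p permutes {..<length as'}" "permute_list p as' = as"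
    using assms(1) by (rule mset_eq_permutation)
  have p': "p permutes {0..<?n}" using p(1) len by (simp add: atLeast0LessThan)
  have nth: "as ! i = as' ! p i" "p i < ?n" if "i < ?n" for i
    using permute_list_nth[OF p(1), of i] p(2) permutes_in_image[OF p', of i] that len by auto
  have "vdm_wrt ev as fs = det (mat ?n ?n (\<lambda>(i, j). ?A $$ (p i, j)))"
    unfolding vdm_wrt_def using assms(2)
    by (intro arg_cong[where f = det] eq_matI) (auto simp: nth nth(2)[unfolded assms(2)])
  also have "\<dots> = signof p * det ?A"
    by (rule det_permute_rows[OF _ p']) simp
  finally have "\<bar>vdm_wrt ev as fs\<bar> = \<bar>det ?A\<bar>"
    by (simp add: abs_mult sign_def)
  then show ?thesis by (simp add: vdm_wrt_def len assms(2))
qed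

lemma abs_vdm_wrt_mset_cong:
  assumes "mset as = mset as'" "mset fs = mset fs'" "length as' = length fs'"
  shows "\<bar>vdm_wrt ev as fs\<bar> = \<bar>vdm_wrt ev as' fs'\<bar>"
proof -
  have len: "length as' = length as" "length fs' = length fs"
    using assms(1,2) by (metis size_mset)+
  have "\<bar>vdm_wrt ev as fs\<bar> = \<bar>vdm_wrt ev as' fs\<bar>"
    using len assms by (intro abs_vdm_wrt_permute_points) auto
  also have "vdm_wrt ev as' fs = vdm_wrt (\<lambda>a f. ev f a) fs as'"
    using len assms(3) by (intro vdm_wrt_flip[symmetric]) simp
  also have "\<bar>\<dots>\<bar> = \<bar>vdm_wrt (\<lambda>a f. ev f a) fs' as'\<bar>"
    using len assms by (intro abs_vdm_wrt_permute_points) auto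
  also have "vdm_wrt (\<lambda>a f. ev f a) fs' as' = vdm_wrt ev as' fs'"
    using len assms(3) by (intro vdm_wrt_flip) simp
  finally show ?thesis .
qed

lemma sum_set_nth:
  assumes "distinct ks"
  shows "(\<Sum>k\<in>set ks. h k) = (\<Sum>i = 0..<length ks. h (ks ! i))"
  using assms by (simp add: sum.distinct_set_conv_list sum_list_sum_nth)

text \<open>Multiplicativity of the determinant, read as a change of basis: if every function of one family is
a combination of the functions \<open>ks\<close>, the two determinants differ by the determinant of the
coefficients. Every comparison of two families below goes through this identity.\<close>

lemma vdm_wrt_mult:
  assumes "distinct ks" "length as = length ks" "length fs = length ks"
  shows "vdm_wrt (\<lambda>f a. \<Sum>k\<in>set ks. c f k * ev k a) as fs
       = vdm_wrt ev as ks * vdm_wrt c ks fs"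
proof -
  let ?n = "length ks"
  let ?A = "mat ?n ?n (\<lambda>(i, j). ev (ks ! j) (as ! i))"
  let ?B = "mat ?n ?n (\<lambda>(i, j). c (fs ! j) (ks ! i))"
  have "vdm_wrt (\<lambda>f a. \<Sum>k\<in>set ks. c f k * ev k a) as fs = det (?A * ?B)"
    unfolding vdm_wrt_def using assms
    by (intro arg_cong[where f = det] eq_matI)
       (auto simp: scalar_prod_def sum_set_nth mult.commute intro!: sum.cong)
  also have "\<dots> = det ?A * det ?B"
    by (rule det_mult) auto
  finally show ?thesis by (simp add: vdm_wrt_def assms)
qed

text \<open>Sorting the indices by \<open>rank\<close> makes the coefficient matrix upper triangular. The rank is only
required to decrease strictly along nonzero off-diagonal coefficients, so unrelated indices may
share a rank.\<close>

lemma abs_vdm_wrt_triangular: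
  fixes rank :: "'k \<Rightarrow> nat"
  assumes "distinct ks"
    and tri: "\<And>f k. f \<in> set ks \<Longrightarrow> k \<in> set ks \<Longrightarrow> f \<noteq> k \<Longrightarrow> c f k \<noteq> 0 \<Longrightarrow> rank k < rank f"
  shows "\<bar>vdm_wrt c ks ks\<bar> = (\<Prod>k\<in>set ks. \<bar>c k k\<bar>)"
proof -
  let ?s = "sort_key rank ks"
  let ?n = "length ks"
  let ?A = "mat ?n ?n (\<lambda>(i, j). c (?s ! j) (?s ! i))"
  have d: "distinct ?s" using assms(1) by simp
  have "\<bar>vdm_wrt c ks ks\<bar> = \<bar>vdm_wrt c ?s ?s\<bar>"
    by (rule abs_vdm_wrt_mset_cong) auto
  also have "vdm_wrt c ?s ?s = det ?A" by (simp add: vdm_wrt_def)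
  also have "det ?A = prod_list (diag_mat ?A)"
  proof (rule det_upper_triangular)
    show "upper_triangular ?A"
    proof
      fix i j assume ij: "j < i" "i < dim_row ?A"
      then have "?s ! i \<noteq> ?s ! j" using d by (simp add: nth_eq_iff_index_eq)
      moreover have "rank (?s ! j) \<le> rank (?s ! i)"
        using sorted_nth_mono[of "map rank ?s" j i] ij by auto
      moreover have "?s ! i \<in> set ks" "?s ! j \<in> set ks"
        using ij nth_mem[of i ?s] nth_mem[of j ?s] by (auto simp del: nth_mem)
      ultimately show "?A $$ (i, j) = 0"
        using ij tri[of "?s ! j" "?s ! i"] by auto
    qed
  qed auto
  also have "diag_mat ?A = map (\<lambda>k. c k k) ?s"
    by (rule nth_equalityI) (auto simp: diag_mat_def)
  also have "prod_list \<dots> = (\<Prod>k\<in>set ks. c k k)"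
    using prod.distinct_set_conv_list[OF d, of "\<lambda>k. c k k"] by simp
  finally show ?thesis by (simp add: abs_prod)
qed

lemma vdm_wrt_block_diagonal:
  assumes "distinct is" "length ss = length js"
  shows "vdm_wrt (\<lambda>(i, j) (i', s). if i = i' then ev i j s else 0)
           (List.product is ss) (List.product is js) = (\<Prod>i\<in>set is. vdm_wrt (ev i) ss js)"
  using assms(1)
proof (induction "is")
  case Nil
  show ?case by (simp add: vdm_wrt_def)
next
  case (Cons i "is")
  let ?ev = "\<lambda>(i, j) (i', s). if i = i' then ev i j s else 0"
  let ?m = "length js" and ?n = "length is * length js"
  let ?A = "mat ?m ?m (\<lambda>(r, c). ev i (js ! c) (ss ! r))"
  let ?D = "mat ?n ?n (\<lambda>(r, c). ?ev (List.product is js ! c) (List.product is ss ! r))"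
  have i: "fst (List.product is zs ! (r - ?m)) \<noteq> i"
    if "r < ?m + ?n" "\<not> r < ?m" "length zs = ?m" for r and zs :: "'z list"
  proof -
    have "r - ?m < length (List.product is zs)" using that by (simp add: less_diff_conv2)
    from nth_mem[OF this] show ?thesis using Cons.prems by (auto simp: mem_Times_iff)
  qed
  have "vdm_wrt ?ev (List.product (i # is) ss) (List.product (i # is) js)
      = det (four_block_mat ?A (0\<^sub>m ?m ?n) (0\<^sub>m ?n ?m) ?D)"
    unfolding vdm_wrt_def
    using assms(2)
    by (intro arg_cong[where f = det] eq_matI)
       (auto simp: nth_append case_prod_beta i i[symmetric] split: if_splits)
  also have "\<dots> = det ?A * det ?D"
    by (rule det_four_block_mat_lower_left_zero) auto
  also have "det ?D = (\<Prod>i\<in>set is. vdm_wrt (ev i) ss js)"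
    using Cons by (simp add: vdm_wrt_def assms(2))
  also have "det ?A = vdm_wrt (ev i) ss js"
    by (simp add: vdm_wrt_def assms(2))
  finally show ?case using Cons.prems by simp
qed

text \<open>The family is linearly dependent on the given points exactly when its determinant vanishes. This
criterion is used in both directions: to extract a dependency from a vanishing determinant, and to
show that a determinant vanishes by exhibiting one.\<close>

lemma vdm_wrt_eq_0_iff:
  assumes "distinct fs" "length as = length fs"
  shows "vdm_wrt ev as fs = 0 \<longleftrightarrow>
    (\<exists>c. (\<exists>f\<in>set fs. c f \<noteq> 0) \<and> (\<forall>a\<in>set as. (\<Sum>f\<in>set fs. c f * ev f a) = 0))"
    (is "_ \<longleftrightarrow> ?rhs")
proof -
  let ?n = "length fs"
  let ?A = "mat ?n ?n (\<lambda>(i, j). ev (fs ! j) (as ! i))"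
  have mult: "(?A *\<^sub>v vec ?n (\<lambda>j. c (fs ! j))) $ i = (\<Sum>f\<in>set fs. c f * ev f (as ! i))"
    if "i < ?n" for c i
    using that assms by (auto simp: scalar_prod_def sum_set_nth mult.commute intro!: sum.cong)
  have "vdm_wrt ev as fs = 0 \<longleftrightarrow>
      (\<exists>v. v \<in> carrier_vec ?n \<and> v \<noteq> 0\<^sub>v ?n \<and> ?A *\<^sub>v v = 0\<^sub>v ?n)"
    unfolding vdm_wrt_def assms(2) by (rule det_0_iff_vec_prod_zero) auto
  also have "\<dots> \<longleftrightarrow> ?rhs"
  proof
    assume "\<exists>v. v \<in> carrier_vec ?n \<and> v \<noteq> 0\<^sub>v ?n \<and> ?A *\<^sub>v v = 0\<^sub>v ?n"
    then obtain v where v: "v \<in> carrier_vec ?n" "v \<noteq> 0\<^sub>v ?n" "?A *\<^sub>v v = 0\<^sub>v ?n"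
      by blast
    define c where "c f = v $ (THE j. j < ?n \<and> fs ! j = f)" for f
    have c: "c (fs ! j) = v $ j" if "j < ?n" for j
      unfolding c_def using that assms(1)
      by (intro arg_cong[where f = "($) v"] the_equality) (auto simp: nth_eq_iff_index_eq)
    have "v = vec ?n (\<lambda>j. c (fs ! j))"
      using v(1) by (intro eq_vecI) (auto simp: c)
    then have "(\<Sum>f\<in>set fs. c f * ev f (as ! i)) = 0" if "i < ?n" for i
      using mult[OF that, of c] v(3) that by (metis index_zero_vec(1))
    moreover obtain j where "j < ?n" "v $ j \<noteq> 0"
      using v(1,2) by (metis carrier_vecD eq_vecI index_zero_vec)
    ultimately show ?rhs
      using c assms(2) by (metis in_set_conv_nth nth_mem)
  next
    assume ?rhs
    then obtain c f where c: "f \<in> set fs" "c f \<noteq> 0"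
      and rel: "\<And>a. a \<in> set as \<Longrightarrow> (\<Sum>f\<in>set fs. c f * ev f a) = 0"
      by blast
    let ?v = "vec ?n (\<lambda>j. c (fs ! j))"
    obtain j where j: "j < ?n" "fs ! j = f" using c(1) by (auto simp: in_set_conv_nth)
    have "?v $ j \<noteq> 0" using j c(2) by simp
    then have "?v \<noteq> 0\<^sub>v ?n" using j(1) by (metis index_zero_vec(1))
    moreover have "?A *\<^sub>v ?v = 0\<^sub>v ?n"
      using mult[of _ c] rel assms(2) by (intro eq_vecI) auto
    ultimately show "\<exists>v. v \<in> carrier_vec ?n \<and> v \<noteq> 0\<^sub>v ?n \<and> ?A *\<^sub>v v = 0\<^sub>v ?n"
      by (intro exI[of _ ?v]) auto
  qed
  finally show ?thesis .
qed

lemma more_functions_than_points_dependent: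
  fixes h :: "'f \<Rightarrow> nat \<Rightarrow> real"
  assumes "p < card F"
  obtains c where "\<exists>f\<in>F. c f \<noteq> 0" "\<And>r. r < p \<Longrightarrow> (\<Sum>f\<in>F. c f * h f r) = 0"
proof -
  have "finite F" using assms card.infinite by fastforce
  then obtain fs where fs: "set fs = F" "distinct fs" using finite_distinct_list by blast
  have len: "length fs = card F" using fs distinct_card by metis
  \<comment> \<open>Zero rows make the matrix square; a zero row is a dependency of the transposed matrix.\<close>
  let ?ev = "\<lambda>f r. if r < p then h f r else 0"
  have "vdm_wrt (\<lambda>r f. ?ev f r) fs [0..<card F] = 0"
    using assms len by (subst vdm_wrt_eq_0_iff) (auto intro!: exI[of _ "\<lambda>r. if r = p then 1 else 0"] bexI[of _ p] sum.neutral)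
  then have "vdm_wrt ?ev [0..<card F] fs = 0"
    using vdm_wrt_flip[of "[0..<card F]" fs ?ev] len by simp
  then obtain c where "\<exists>f\<in>set fs. c f \<noteq> 0"
    and rel: "\<forall>r\<in>set [0..<card F]. (\<Sum>f\<in>set fs. c f * ?ev f r) = 0"
    using vdm_wrt_eq_0_iff[OF fs(2), of "[0..<card F]" ?ev] len by auto
  show thesis
  proof (rule that)
    show "\<exists>f\<in>F. c f \<noteq> 0" using \<open>\<exists>f\<in>set fs. c f \<noteq> 0\<close> fs(1) by simp
    show "(\<Sum>f\<in>F. c f * h f r) = 0" if "r < p" for r
      using bspec[OF rel, of r] that assms fs(1) by simp
  qed
qed


lemma vdm_wrt_cong_set:
  assumes "\<And>f a. f \<in> set fs \<Longrightarrow> a \<in> set as \<Longrightarrow> ev f a = ev' f a"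
  shows "vdm_wrt ev as fs = vdm_wrt ev' as fs"
  using assms by (intro vdm_wrt_cong) auto

text \<open>The matrix is the product of \<open>e \<otimes> I\<close>, which is block diagonal once the second coordinate is
listed first, with the block diagonal matrix whose \<open>i\<close>-th block is that of \<open>q i\<close>. It matters
that the second factor may depend on \<open>i\<close> whereas \<open>e\<close> depends on \<open>i\<close> alone.\<close>

lemma abs_vdm_wrt_tensor:
  assumes "distinct is" "distinct js"
  shows "\<bar>vdm_wrt (\<lambda>(i, j) (r, s). e i r * q i j s) (List.product is js) (List.product is js)\<bar>
       = \<bar>vdm_wrt e is is\<bar> ^ length js * (\<Prod>i\<in>set is. \<bar>vdm_wrt (q i) js js\<bar>)"
proof -
  let ?K = "List.product is js" and ?K' = "List.product js is"
  let ?C = "\<lambda>(i, j) (i', s'). if i = i' then q i j s' else 0"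
  let ?E = "\<lambda>(i', s') (r, s). if s' = s then e i' r else 0"
  have dK: "distinct ?K" using assms by (simp add: distinct_product)
  have "vdm_wrt (\<lambda>(i, j) (r, s). e i r * q i j s) ?K ?K
      = vdm_wrt (\<lambda>f a. \<Sum>k\<in>set ?K. ?C f k * ?E k a) ?K ?K"
  proof (rule vdm_wrt_cong_set)
    fix f a assume "f \<in> set ?K" "a \<in> set ?K"
    then obtain i j r s where fa: "f = (i, j)" "a = (r, s)" "i \<in> set is" "s \<in> set js"
      by auto
    have "(\<Sum>k\<in>set ?K. ?C f k * ?E k a)
        = (\<Sum>i'\<in>set is. \<Sum>s'\<in>set js. if i' = i then if s' = s then q i j s * e i r else 0 else 0)"
      unfolding fa set_product sum.cartesian_product by (intro sum.cong) auto
    also have "\<dots> = (\<Sum>i'\<in>set is. if i' = i then q i j s * e i r else 0)"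
      using fa(4) by (intro sum.cong) auto
    also have "\<dots> = q i j s * e i r" using fa(3) by simp
    finally show "(case f of (i, j) \<Rightarrow> \<lambda>(r, s). e i r * q i j s) a
        = (\<Sum>k\<in>set ?K. ?C f k * ?E k a)"
      by (simp add: fa mult.commute)
  qed
  also have "\<dots> = vdm_wrt ?E ?K ?K * vdm_wrt ?C ?K ?K"
    using dK by (rule vdm_wrt_mult) auto
  also have "vdm_wrt ?C ?K ?K = (\<Prod>i\<in>set is. vdm_wrt (q i) js js)"
    using assms by (intro vdm_wrt_block_diagonal) auto
  finally have *: "\<bar>vdm_wrt (\<lambda>(i, j) (r, s). e i r * q i j s) ?K ?K\<bar>
      = \<bar>vdm_wrt ?E ?K ?K\<bar> * (\<Prod>i\<in>set is. \<bar>vdm_wrt (q i) js js\<bar>)"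
    by (simp add: abs_mult abs_prod)
  \<comment> \<open>Listing the second coordinate first turns \<open>e \<otimes> I\<close> into \<open>length js\<close> equal diagonal blocks.\<close>
  have "mset ?K = mset (map prod.swap ?K')"
    using assms by (subst set_eq_iff_mset_eq_distinct[symmetric])
      (auto simp: distinct_product distinct_map)
  then have "\<bar>vdm_wrt ?E ?K ?K\<bar> = \<bar>vdm_wrt ?E (map prod.swap ?K') (map prod.swap ?K')\<bar>"
    by (intro abs_vdm_wrt_mset_cong) auto
  also have "vdm_wrt ?E (map prod.swap ?K') (map prod.swap ?K')
      = vdm_wrt (\<lambda>(s', i') (s, r). if s' = s then e i' r else 0) ?K' ?K'"
    unfolding vdm_wrt_map by (rule vdm_wrt_cong_set) auto
  also have "\<dots> = (\<Prod>s\<in>set js. vdm_wrt e is is)"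
    using assms by (intro vdm_wrt_block_diagonal) auto
  also have "\<dots> = vdm_wrt e is is ^ length js"
    using assms by (simp add: distinct_card)
  finally show ?thesis using * by (simp add: power_abs)
qed

section \<open>Staircase arrays of products\<close>

context
  fixes u w f g :: "nat \<Rightarrow> nat \<Rightarrow> real" and m :: nat
begin

text \<open>Points of the two factors are represented by their indices, so \<open>u k r\<close> is the value of the
  \<open>k\<close>-th function at the \<open>r\<close>-th point. The cells \<open>(k, j)\<close> of an \<open>m \<times> (m + 1)\<close> array are divided by
  the staircase \<open>j \<le> k\<close>. The family \<open>stair_col j\<close> starts with \<open>u\<close> and changes to \<open>w\<close> at position
  \<open>j\<close>; the family \<open>stair_row k\<close> starts with \<open>f\<close> and continues with \<open>g\<close> from its beginning.\<close>

definition stair_col :: "nat \<Rightarrow> nat \<Rightarrow> nat \<Rightarrow> real" where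
  "stair_col j k = (if j \<le> k then w k else u k)"

definition stair_row :: "nat \<Rightarrow> nat \<Rightarrow> nat \<Rightarrow> real" where
  "stair_row k j = (if j \<le> k then f j else g (j - Suc k))"

definition stair :: "nat \<times> nat \<Rightarrow> nat \<times> nat \<Rightarrow> real" where
  "stair = (\<lambda>(k, j) (r, s). stair_col j k r * stair_row k j s)"

abbreviation "cells \<equiv> List.product [0..<m] [0..<Suc m]"

text \<open>A dependency among the functions \<open>stair_col j\<close> splits into an equality \<open>e = - e'\<close>, where \<open>e\<close> is a
combination of the \<open>w k\<close> with \<open>k \<ge> j\<close> and \<open>e'\<close> one of the \<open>u k\<close> with \<open>k < j\<close>. Reading \<open>e\<close> in the
first way, the products of \<open>e\<close> with \<open>f 0, \<dots>, f j\<close> lie in the span of the staircase family; reading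
it in the second way, so do its products with \<open>g 0, \<dots>, g (m - j)\<close>. These are \<open>m + 2\<close> functions on
the second factor, which has \<open>m + 1\<close> points, so some combination of them vanishes and its product
with \<open>e\<close> is a dependency in the family.\<close>

lemma stair_degenerate:
  assumes "j \<le> m" and det0: "vdm_wrt (stair_col j) [0..<m] [0..<m] = 0"
  shows "vdm_wrt stair cells cells = 0"
proof -
  obtain v where v: "\<exists>k\<in>set [0..<m]. v k \<noteq> 0"
    and rel': "\<forall>r\<in>set [0..<m]. (\<Sum>k\<in>set [0..<m]. v k * stair_col j k r) = 0"
    using det0 by (subst (asm) vdm_wrt_eq_0_iff) auto
  have rel: "(\<Sum>k = 0..<m. v k * stair_col j k r) = 0" if "r < m" for r
    using rel' that by simp
  define e where "e r = (\<Sum>k = j..<m. v k * w k r)" for r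
  have e': "e r = - (\<Sum>k = 0..<j. v k * u k r)" if "r < m" for r
  proof -
    have "(\<Sum>k = 0..<m. v k * stair_col j k r)
        = (\<Sum>k = 0..<j. v k * stair_col j k r) + (\<Sum>k = j..<m. v k * stair_col j k r)"
      using assms(1) by (simp add: sum.atLeastLessThan_concat)
    also have "\<dots> = (\<Sum>k = 0..<j. v k * u k r) + e r"
      unfolding e_def stair_col_def by (intro arg_cong2[where f = "(+)"] sum.cong) auto
    finally show ?thesis using rel[OF that] by simp
  qed
  let ?F = "\<lambda>c s. \<Sum>i = 0..<Suc j. c i * f i s"
  let ?G = "\<lambda>c s. \<Sum>i = 0..<Suc (m - j). c (Suc (j + i)) * g i s"
  obtain c where c: "\<And>r s. r < m \<Longrightarrow> s < Suc m \<Longrightarrow> e r * (?F c s + ?G c s) = 0"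
    and nz: "(\<exists>k. j \<le> k \<and> k < m \<and> v k \<noteq> 0 \<and> (\<exists>i\<le>j. c i \<noteq> 0)) \<or>
             (\<exists>k<j. v k \<noteq> 0 \<and> (\<exists>i\<le>m - j. c (Suc (j + i)) \<noteq> 0))"
  proof -
    \<comment> \<open>If the dependency involves only one of \<open>u\<close> and \<open>w\<close>, then \<open>e = 0\<close> and any \<open>c\<close> satisfies the
      equation; a unit vector then keeps the resulting coefficients from vanishing.\<close>
    consider (low) "\<forall>k. j \<le> k \<and> k < m \<longrightarrow> v k = 0" | (high) "\<forall>k<j. v k = 0"
      | (both) "\<exists>k. j \<le> k \<and> k < m \<and> v k \<noteq> 0" "\<exists>k<j. v k \<noteq> 0"
      by blast
    then show thesis
    proof cases
      case low
      then have "e r = 0" for r unfolding e_def by (intro sum.neutral) auto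
      moreover have "\<exists>k<j. v k \<noteq> 0" using v low by (metis atLeastLessThan_iff not_le set_upt)
      ultimately show thesis
        by (intro that[of "\<lambda>i. if i = Suc j then 1 else 0"]) auto
    next
      case high
      then have "e r = 0" if "r < m" for r unfolding e'[OF that] by (simp add: sum.neutral)
      moreover have "\<exists>k. j \<le> k \<and> k < m \<and> v k \<noteq> 0" using v high by (metis atLeastLessThan_iff not_le set_upt)
      ultimately show thesis
        by (intro that[of "\<lambda>i. if i = 0 then 1 else 0"]) auto
    next
      case both
      let ?h = "\<lambda>i. if i \<le> j then f i else g (i - Suc j)"
      obtain c where c: "\<exists>i\<in>{0..<Suc (Suc m)}. c i \<noteq> 0"
        and crel: "\<And>s. s < Suc m \<Longrightarrow> (\<Sum>i = 0..<Suc (Suc m). c i * ?h i s) = 0"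
        using more_functions_than_points_dependent[of "Suc m" "{0..<Suc (Suc m)}" ?h] by auto
      have "?F c s + ?G c s = 0" if "s < Suc m" for s
      proof -
        have "(\<Sum>i = 0..<Suc (Suc m). c i * ?h i s)
            = (\<Sum>i = 0..<Suc j. c i * ?h i s) + (\<Sum>i = Suc j..<Suc (Suc m). c i * ?h i s)"
          using assms(1) by (intro sum.atLeastLessThan_concat[symmetric]) auto
        also have "(\<Sum>i = Suc j..<Suc (Suc m). c i * ?h i s) = ?G c s"
          using assms(1)
          by (intro sum.reindex_bij_witness[of _ "\<lambda>i. Suc (j + i)" "\<lambda>i. i - Suc j"]) auto
        also have "(\<Sum>i = 0..<Suc j. c i * ?h i s) = ?F c s"
          by (intro sum.cong) auto
        finally show ?thesis using crel[OF that] by simp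
      qed
      moreover have "(\<exists>i\<le>j. c i \<noteq> 0) \<or> (\<exists>i\<le>m - j. c (Suc (j + i)) \<noteq> 0)"
      proof -
        obtain i where i: "i < Suc (Suc m)" "c i \<noteq> 0" using c by auto
        show ?thesis
        proof (cases "i \<le> j")
          case False
          then have "Suc (j + (i - Suc j)) = i" "i - Suc j \<le> m - j" using i by auto
          then show ?thesis using i(2) by metis
        qed (use i in blast)
      qed
      ultimately show thesis using both by (intro that[of c]) auto
    qed
  qed
  \<comment> \<open>The coefficients of the product of \<open>e\<close> with the combination given by \<open>c\<close>; in the products with
    \<open>g\<close> the function \<open>e\<close> is expanded in \<open>u\<close>, whence the sign.\<close>
  define C where "C = (\<lambda>(k, l). if j \<le> k then if l \<le> j then v k * c l else 0
      else if k < l \<and> l \<le> Suc k + (m - j) then - v k * c (Suc (j + (l - Suc k))) else 0)"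
  have "(\<Sum>p\<in>set cells. C p * stair p (r, s)) = 0" if rs: "r < m" "s < Suc m" for r s
  proof -
    let ?S = "\<lambda>k. \<Sum>l = 0..<Suc m. C (k, l) * stair (k, l) (r, s)"
    have high: "?S k = v k * w k r * ?F c s" if "j \<le> k" for k
    proof -
      have "?S k = (\<Sum>l = 0..<Suc j. C (k, l) * stair (k, l) (r, s))"
        using that assms(1) by (intro sum.mono_neutral_right) (auto simp: C_def)
      also have "\<dots> = (\<Sum>l = 0..<Suc j. v k * w k r * (c l * f l s))"
        using that by (intro sum.cong) (auto simp: C_def stair_def stair_col_def stair_row_def)
      finally show ?thesis by (simp only: sum_distrib_left)
    qed
    have low: "?S k = - (v k * u k r) * ?G c s" if "k < j" for k
    proof -
      have "?S k = (\<Sum>l = Suc k..<Suc k + Suc (m - j). C (k, l) * stair (k, l) (r, s))"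
        using that assms(1) by (intro sum.mono_neutral_right) (auto simp: C_def)
      also have "\<dots> = (\<Sum>i = 0..<Suc (m - j). - (v k * u k r) * (c (Suc (j + i)) * g i s))"
        using that
        by (intro sum.reindex_bij_witness[of _ "\<lambda>i. Suc k + i" "\<lambda>l. l - Suc k"])
           (auto simp: C_def stair_def stair_col_def stair_row_def)
      finally show ?thesis by (simp only: sum_distrib_left)
    qed
    have "(\<Sum>p\<in>set cells. C p * stair p (r, s)) = (\<Sum>k = 0..<m. ?S k)"
      by (simp only: set_product set_upt sum.cartesian_product case_prod_unfold prod.collapse)
    also have "\<dots> = (\<Sum>k = 0..<j. ?S k) + (\<Sum>k = j..<m. ?S k)"
      using assms(1) by (simp only: sum.atLeastLessThan_concat)
    also have "(\<Sum>k = j..<m. ?S k) = e r * ?F c s"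
      unfolding e_def sum_distrib_right by (intro sum.cong) (auto simp only: high atLeastLessThan_iff)
    also have "(\<Sum>k = 0..<j. ?S k) = e r * ?G c s"
      unfolding e'[OF rs(1)] sum_negf[symmetric] sum_distrib_right
      by (intro sum.cong) (auto simp only: low atLeastLessThan_iff)
    also have "e r * ?G c s + e r * ?F c s = e r * (?F c s + ?G c s)"
      by (simp only: distrib_left add.commute)
    finally show ?thesis using c[OF rs] by simp
  qed
  moreover have "\<exists>p\<in>set cells. C p \<noteq> 0"
    using nz
  proof (elim disjE exE conjE)
    fix k i assume "j \<le> k" "k < m" "v k \<noteq> 0" "i \<le> j" "c i \<noteq> 0"
    then show ?thesis by (intro bexI[of _ "(k, i)"]) (auto simp: C_def)
  next
    fix k i assume "k < j" "v k \<noteq> 0" "i \<le> m - j" "c (Suc (j + i)) \<noteq> 0"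
    with assms(1) show ?thesis by (intro bexI[of _ "(k, Suc k + i)"]) (auto simp: C_def)
  qed
  ultimately show ?thesis
    by (subst vdm_wrt_eq_0_iff) (auto simp: distinct_product intro!: exI[of _ C])
qed

text \<open>The \<open>m + 1\<close> functions \<open>u 0, \<dots>, u k, w k, \<dots>, w (m - 1)\<close> are dependent on \<open>m\<close> points, and a dependency
is an equality between a combination of the \<open>u\<close> and one of the \<open>w\<close>. If \<open>u k\<close> did not occur, it would
be a dependency of \<open>stair_col k\<close>; if \<open>w k\<close> did not occur, one of \<open>stair_col (Suc k)\<close>. The common value
spans the line in which two opposite flags of subspaces meet.\<close>

lemma exchange_vectors:
  assumes "k < m"
    and "vdm_wrt (stair_col k) [0..<m] [0..<m] \<noteq> 0"
    and "vdm_wrt (stair_col (Suc k)) [0..<m] [0..<m] \<noteq> 0"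
  obtains \<alpha> \<beta> :: "nat \<Rightarrow> real" where "\<alpha> k \<noteq> 0" "\<beta> k \<noteq> 0"
    "\<And>r. r < m \<Longrightarrow> (\<Sum>i = 0..<Suc k. \<alpha> i * u i r) = (\<Sum>i = k..<m. \<beta> i * w i r)"
proof -
  let ?h = "\<lambda>i. if i \<le> k then u i else w (i - 1)"
  obtain c where c: "\<exists>i\<in>{0..<Suc m}. c i \<noteq> 0"
    and rel: "\<And>r. r < m \<Longrightarrow> (\<Sum>i = 0..<Suc m. c i * ?h i r) = 0"
    using more_functions_than_points_dependent[of m "{0..<Suc m}" ?h] by auto
  define \<beta> where "\<beta> i = - c (Suc i)" for i
  have eq: "(\<Sum>i = 0..<Suc k. c i * u i r) = (\<Sum>i = k..<m. \<beta> i * w i r)" if "r < m" for r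
  proof -
    have "(\<Sum>i = 0..<Suc m. c i * ?h i r)
        = (\<Sum>i = 0..<Suc k. c i * ?h i r) + (\<Sum>i = Suc k..<Suc m. c i * ?h i r)"
      using assms(1) by (intro sum.atLeastLessThan_concat[symmetric]) auto
    also have "(\<Sum>i = 0..<Suc k. c i * ?h i r) = (\<Sum>i = 0..<Suc k. c i * u i r)"
      by (intro sum.cong) auto
    also have "(\<Sum>i = Suc k..<Suc m. c i * ?h i r) = - (\<Sum>i = k..<m. \<beta> i * w i r)"
      unfolding sum.shift_bounds_Suc_ivl by (simp add: \<beta>_def sum_negf)
    finally show ?thesis using rel[OF that] by simp
  qed
  have nz: "(\<exists>i<Suc k. c i \<noteq> 0) \<or> (\<exists>i. k \<le> i \<and> i < m \<and> \<beta> i \<noteq> 0)"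
  proof -
    obtain i where i: "i < Suc m" "c i \<noteq> 0" using c by auto
    show ?thesis
    proof (cases "i < Suc k")
      case False
      then show ?thesis using i by (intro disjI2 exI[of _ "i - 1"]) (auto simp: \<beta>_def)
    qed (use i in blast)
  qed
  have dependent: "vdm_wrt (stair_col j) [0..<m] [0..<m] = 0"
    if j: "j = k \<and> c k = 0 \<or> j = Suc k \<and> \<beta> k = 0" for j
  proof -
    define v where "v i = (if i < j then c i else - \<beta> i)" for i
    have jm: "j \<le> m" using j assms(1) by auto
    have "\<exists>i<m. v i \<noteq> 0"
      using nz
    proof (elim disjE exE conjE)
      fix i assume "i < Suc k" "c i \<noteq> 0"
      moreover from this have "i < j" using j less_Suc_eq by auto
      ultimately show ?thesis using jm by (intro exI[of _ i]) (auto simp: v_def)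
    next
      fix i assume "k \<le> i" "i < m" "\<beta> i \<noteq> 0"
      moreover from this have "j \<le> i" using j by (cases "i = k") auto
      ultimately show ?thesis by (intro exI[of _ i]) (auto simp: v_def)
    qed
    moreover have "(\<Sum>i = 0..<m. v i * stair_col j i r) = 0" if "r < m" for r
    proof -
      have "(\<Sum>i = 0..<m. v i * stair_col j i r)
          = (\<Sum>i = 0..<j. v i * stair_col j i r) + (\<Sum>i = j..<m. v i * stair_col j i r)"
        using jm by (simp add: sum.atLeastLessThan_concat)
      also have "(\<Sum>i = 0..<j. v i * stair_col j i r) = (\<Sum>i = 0..<j. c i * u i r)"
        by (intro sum.cong) (auto simp: v_def stair_col_def)
      also have "\<dots> = (\<Sum>i = 0..<Suc k. c i * u i r)"
        using j by auto
      also have "(\<Sum>i = j..<m. v i * stair_col j i r) = - (\<Sum>i = j..<m. \<beta> i * w i r)"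
        unfolding sum_negf[symmetric] by (intro sum.cong) (auto simp: v_def stair_col_def)
      also have "(\<Sum>i = j..<m. \<beta> i * w i r) = (\<Sum>i = k..<m. \<beta> i * w i r)"
        using j assms(1) by (auto simp: sum.atLeast_Suc_lessThan)
      finally show ?thesis using eq[OF that] by simp
    qed
    ultimately show ?thesis
      by (subst vdm_wrt_eq_0_iff) (auto intro!: exI[of _ v])
  qed
  show thesis
  proof (rule that[of c \<beta>])
    show "c k \<noteq> 0" using dependent[of k] assms(2) by auto
    show "\<beta> k \<noteq> 0" using dependent[of "Suc k"] assms(3) by auto
  qed (rule eq)
qed

text \<open>Let \<open>e k\<close> be the function of the preceding lemma, which is at once a combination of
\<open>u 0, \<dots>, u k\<close> and of \<open>w k, \<dots>, w (m - 1)\<close>. Replace the first factor of the cell \<open>(k, j)\<close> by \<open>e k\<close>,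
expanded in \<open>w\<close> on one side of the staircase and in \<open>u\<close> on the other. Either expansion stays on its
own side: on the first along the column \<open>j\<close>, on the second along the diagonal \<open>j - k = const\<close>, where
the function of the second factor is the same. So the change of family is triangular, with the
leading coefficients of the \<open>e k\<close> on its diagonal, and the new family is of the tensor form treated
above. The same coefficients relate \<open>e\<close> to each \<open>stair_col j\<close>, and therefore they cancel.\<close>

lemma stair_nondegenerate:
  assumes nz: "\<And>j. j \<le> m \<Longrightarrow> vdm_wrt (stair_col j) [0..<m] [0..<m] \<noteq> 0"
  shows "\<bar>vdm_wrt stair cells cells\<bar>
       = (\<Prod>j<Suc m. \<bar>vdm_wrt (stair_col j) [0..<m] [0..<m]\<bar>)
       * (\<Prod>k<m. \<bar>vdm_wrt (stair_row k) [0..<Suc m] [0..<Suc m]\<bar>)"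
proof -
  have "\<forall>k\<in>{..<m}. \<exists>p. fst p k \<noteq> 0 \<and> snd p k \<noteq> 0 \<and>
      (\<forall>r<m. (\<Sum>i = 0..<Suc k. fst p i * u i r) = (\<Sum>i = k..<m. snd p i * w i r))"
  proof
    fix k assume "k \<in> {..<m}"
    then have k: "k < m" by simp
    show "\<exists>p. fst p k \<noteq> 0 \<and> snd p k \<noteq> 0 \<and>
      (\<forall>r<m. (\<Sum>i = 0..<Suc k. fst p i * u i r) = (\<Sum>i = k..<m. snd p i * w i r))"
      using exchange_vectors[OF k nz nz] k by (metis Suc_leI fst_conv less_imp_le snd_conv)
  qed
  from bchoice[OF this] obtain p where "\<forall>k\<in>{..<m}. fst (p k) k \<noteq> 0 \<and> snd (p k) k \<noteq> 0 \<and>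
      (\<forall>r<m. (\<Sum>i = 0..<Suc k. fst (p k) i * u i r) = (\<Sum>i = k..<m. snd (p k) i * w i r))" ..
  note p = bspec[OF this, OF lessThan_iff[THEN iffD2]]
  define \<alpha> \<beta> where "\<alpha> k = fst (p k)" and "\<beta> k = snd (p k)" for k
  define e where "e k r = (\<Sum>i = 0..<Suc k. \<alpha> k i * u i r)" for k r
  have e': "e k r = (\<Sum>i = k..<m. \<beta> k i * w i r)" if "k < m" "r < m" for k r
    using p[OF that(1)] that(2) by (simp add: e_def \<alpha>_def \<beta>_def)
  define c where "c j k i = (if j \<le> k then if k \<le> i then \<beta> k i else 0
      else if i \<le> k then \<alpha> k i else 0)" for j k i
  have c_nz: "c j k k \<noteq> 0" if "k < m" for j k
    using p[OF that] by (simp add: c_def \<alpha>_def \<beta>_def)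
  have expand: "e k r = (\<Sum>i = 0..<m. c j k i * stair_col j i r)" if "k < m" "r < m" for j k r
  proof (cases "j \<le> k")
    case True
    have "(\<Sum>i = 0..<m. c j k i * stair_col j i r) = (\<Sum>i = k..<m. c j k i * stair_col j i r)"
      using True by (intro sum.mono_neutral_right) (auto simp: c_def)
    also have "\<dots> = e k r"
      unfolding e'[OF that] using True by (intro sum.cong) (auto simp: c_def stair_col_def)
    finally show ?thesis ..
  next
    case False
    have "(\<Sum>i = 0..<m. c j k i * stair_col j i r)
        = (\<Sum>i = 0..<Suc k. c j k i * stair_col j i r)"
      using False that by (intro sum.mono_neutral_right) (auto simp: c_def)
    also have "\<dots> = e k r"
      unfolding e_def using False by (intro sum.cong) (auto simp: c_def stair_col_def)
    finally show ?thesis ..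
  qed
  have col: "\<bar>vdm_wrt e [0..<m] [0..<m]\<bar>
      = \<bar>vdm_wrt (stair_col j) [0..<m] [0..<m]\<bar> * (\<Prod>k<m. \<bar>c j k k\<bar>)" for j
  proof -
    have "vdm_wrt e [0..<m] [0..<m]
        = vdm_wrt (\<lambda>k r. \<Sum>i\<in>set [0..<m]. c j k i * stair_col j i r) [0..<m] [0..<m]"
      by (rule vdm_wrt_cong_set) (simp add: expand[of _ _ j])
    also have "\<dots> = vdm_wrt (stair_col j) [0..<m] [0..<m] * vdm_wrt (c j) [0..<m] [0..<m]"
      by (rule vdm_wrt_mult) auto
    finally have "\<bar>vdm_wrt e [0..<m] [0..<m]\<bar>
        = \<bar>vdm_wrt (stair_col j) [0..<m] [0..<m]\<bar> * \<bar>vdm_wrt (c j) [0..<m] [0..<m]\<bar>"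
      by (simp only: abs_mult)
    also have "\<bar>vdm_wrt (c j) [0..<m] [0..<m]\<bar> = (\<Prod>k\<in>set [0..<m]. \<bar>c j k k\<bar>)"
      by (rule abs_vdm_wrt_triangular[where rank = "\<lambda>k. if j \<le> k then m - k else k"])
         (auto simp: c_def split: if_splits)
    finally show ?thesis by (simp add: atLeast0LessThan)
  qed
  \<comment> \<open>The column in row \<open>i\<close> whose second factor equals that of the cell \<open>(k, j)\<close>: the same column below
    the staircase, the same diagonal above it.\<close>
  define J where "J j k i = (if j \<le> k then j else i + j - k)" for j k i :: nat
  define C where "C = (\<lambda>(k, j) (i, l). if l = J j k i then c j k i else 0)"
  have shift: "J j k i < Suc m \<and> stair_col (J j k i) i = stair_col j i
      \<and> stair_row i (J j k i) = stair_row k j"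
    if "c j k i \<noteq> 0" "k < m" "j < Suc m" for j k i
  proof (cases "j \<le> k")
    case True
    then have "k \<le> i" using that(1) by (auto simp: c_def split: if_splits)
    then show ?thesis using True that(3) by (simp add: J_def stair_col_def stair_row_def)
  next
    case False
    then have "i \<le> k" using that(1) by (auto simp: c_def split: if_splits)
    then have "\<not> j \<le> i" "\<not> i + j - k \<le> i" "i + j - k < Suc m" "i + j - k - Suc i = j - Suc k"
      using False that(3) by auto
    then show ?thesis using False by (simp add: J_def stair_col_def stair_row_def)
  qed
  let ?M = "\<lambda>(k, j) (r, s). e k r * stair_row k j s"
  have "vdm_wrt ?M cells cells
      = vdm_wrt (\<lambda>p a. \<Sum>q\<in>set cells. C p q * stair q a) cells cells"
  proof (rule vdm_wrt_cong_set)
    fix p a assume "p \<in> set cells" "a \<in> set cells"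
    then obtain k j r s where pa: "p = (k, j)" "a = (r, s)" "k < m" "j < Suc m" "r < m" "s < Suc m"
      by auto
    have "(\<Sum>q\<in>set cells. C p q * stair q a)
        = (\<Sum>i = 0..<m. \<Sum>l = 0..<Suc m. if l = J j k i then c j k i * stair (i, l) a else 0)"
      unfolding set_product set_upt sum.cartesian_product
      by (intro sum.cong) (auto simp: pa C_def)
    also have "\<dots> = (\<Sum>i = 0..<m. c j k i * stair_col j i r * stair_row k j s)"
    proof (intro sum.cong refl)
      fix i
      show "(\<Sum>l = 0..<Suc m. if l = J j k i then c j k i * stair (i, l) a else 0)
          = c j k i * stair_col j i r * stair_row k j s"
        using shift[OF _ pa(3,4), of i]
        by (cases "c j k i = 0") (auto simp: pa(2) stair_def)
    qed
    also have "\<dots> = e k r * stair_row k j s"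
      by (simp add: expand[OF pa(3,5), of j] sum_distrib_right)
    finally show "?M p a = (\<Sum>q\<in>set cells. C p q * stair q a)"
      by (simp add: pa)
  qed
  also have "\<dots> = vdm_wrt stair cells cells * vdm_wrt C cells cells"
    by (rule vdm_wrt_mult) (auto simp: distinct_product)
  finally have "\<bar>vdm_wrt ?M cells cells\<bar>
      = \<bar>vdm_wrt stair cells cells\<bar> * \<bar>vdm_wrt C cells cells\<bar>"
    by (simp only: abs_mult)
  also have "\<bar>vdm_wrt C cells cells\<bar> = (\<Prod>q\<in>set cells. \<bar>C q q\<bar>)"
  proof (rule abs_vdm_wrt_triangular[where rank = "\<lambda>(k, j). if j \<le> k then m - k else k"])
    fix p q assume mem: "p \<in> set cells" "q \<in> set cells" and ne: "p \<noteq> q" and nz: "C p q \<noteq> 0"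
    obtain k j i l where pq: "p = (k, j)" "q = (i, l)" "k < m" "i < m" using mem by auto
    have l: "l = J j k i" and c: "c j k i \<noteq> 0"
      using nz by (auto simp: C_def pq(1,2) split: if_splits)
    show "(case q of (k, j) \<Rightarrow> if j \<le> k then m - k else k)
        < (case p of (k, j) \<Rightarrow> if j \<le> k then m - k else k)"
    proof (cases "j \<le> k")
      case True
      then have "l = j" "k \<le> i" using l c by (auto simp: J_def c_def split: if_splits)
      then show ?thesis using True ne pq by auto
    next
      case False
      then have "l = i + j - k" "i \<le> k" using l c by (auto simp: J_def c_def split: if_splits)
      then show ?thesis using False ne pq by auto
    qed
  qed (simp add: distinct_product)
  also have "\<dots> = (\<Prod>k<m. \<Prod>j<Suc m. \<bar>c j k k\<bar>)"
    unfolding set_product set_upt prod.cartesian_product atLeast0LessThan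
    by (intro prod.cong) (auto simp: C_def J_def)
  also have "\<dots> = (\<Prod>j<Suc m. \<Prod>k<m. \<bar>c j k k\<bar>)"
    by (rule prod.swap)
  finally have 1: "\<bar>vdm_wrt ?M cells cells\<bar>
      = \<bar>vdm_wrt stair cells cells\<bar> * (\<Prod>j<Suc m. \<Prod>k<m. \<bar>c j k k\<bar>)" .
  have "\<bar>vdm_wrt ?M cells cells\<bar> = (\<Prod>j<Suc m. \<bar>vdm_wrt e [0..<m] [0..<m]\<bar>)
      * (\<Prod>k<m. \<bar>vdm_wrt (stair_row k) [0..<Suc m] [0..<Suc m]\<bar>)"
    by (subst abs_vdm_wrt_tensor) (simp_all add: atLeast0LessThan)
  also have "(\<Prod>j<Suc m. \<bar>vdm_wrt e [0..<m] [0..<m]\<bar>)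
      = (\<Prod>j<Suc m. \<bar>vdm_wrt (stair_col j) [0..<m] [0..<m]\<bar>) * (\<Prod>j<Suc m. \<Prod>k<m. \<bar>c j k k\<bar>)"
    unfolding prod.distrib[symmetric] by (intro prod.cong refl col)
  finally have 2: "\<bar>vdm_wrt ?M cells cells\<bar>
      = (\<Prod>j<Suc m. \<bar>vdm_wrt (stair_col j) [0..<m] [0..<m]\<bar>)
      * (\<Prod>k<m. \<bar>vdm_wrt (stair_row k) [0..<Suc m] [0..<Suc m]\<bar>)
      * (\<Prod>j<Suc m. \<Prod>k<m. \<bar>c j k k\<bar>)"
    by (simp only: mult_ac)
  have "(\<Prod>j<Suc m. \<Prod>k<m. \<bar>c j k k\<bar>) \<noteq> 0"
    using c_nz by simp
  from iffD1[OF mult_right_cancel[OF this] trans[OF 1[symmetric] 2]] show ?thesis .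
qed

text \<open>When some \<open>stair_col j\<close> is dependent, both sides vanish; otherwise the triangular change of
family applies.\<close>

theorem abs_vdm_wrt_stair:
  "\<bar>vdm_wrt stair cells cells\<bar>
       = (\<Prod>j<Suc m. \<bar>vdm_wrt (stair_col j) [0..<m] [0..<m]\<bar>)
       * (\<Prod>k<m. \<bar>vdm_wrt (stair_row k) [0..<Suc m] [0..<Suc m]\<bar>)"
proof (cases "\<forall>j\<le>m. vdm_wrt (stair_col j) [0..<m] [0..<m] \<noteq> 0")
  case True
  then show ?thesis by (intro stair_nondegenerate) auto
next
  case False
  then obtain j where j: "j \<le> m" "vdm_wrt (stair_col j) [0..<m] [0..<m] = 0" by blast
  then have "(\<Prod>j<Suc m. \<bar>vdm_wrt (stair_col j) [0..<m] [0..<m]\<bar>) = 0"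
    by (intro prod_zero) auto
  with stair_degenerate[OF j] show ?thesis by simp
qed

end

section \<open>Even grids and their polynomials\<close>

lemma monic_odd_annihilator: "lead_coeff (odd_annihilator n z) = 1"
  by (simp add: odd_annihilator_def lead_coeff_prod)

lemma odd_annihilator_nonzero: "odd_annihilator n z \<noteq> 0"
  using monic_odd_annihilator[of n z] by auto

lemma degree_odd_annihilator: "degree (odd_annihilator n z) = Suc (n div 2)"
  by (simp add: odd_annihilator_def degree_prod_eq_sum_degree)

text \<open>The cell \<open>(k, j)\<close> carries \<open>a(x) x\<^sup>\<alpha> y\<^sup>\<beta>\<close> with \<open>\<alpha> = m - 1 - k\<close>, \<open>\<beta> = j\<close> on one side of the
  staircase and \<open>b(y) x\<^sup>\<alpha> y\<^sup>\<beta>\<close> with \<open>\<alpha> = k\<close>, \<open>\<beta> = j - 1 - k\<close> on the other. In the columns of \<open>P\<close> the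
  powers in \<open>a(x) x\<^sup>\<alpha>\<close> increase downwards; here they decrease, so that the first factor depends on
  \<open>j\<close> only through the side of the staircase.\<close>

definition stair_poly :: "real poly \<Rightarrow> real poly \<Rightarrow> nat \<Rightarrow> nat \<times> nat \<Rightarrow> bipoly" where
  "stair_poly a b m = (\<lambda>(k, j).
     if j \<le> k then in_x a * in_x (monom 1 (m - Suc k)) * in_y (monom 1 j)
     else in_y b * in_x (monom 1 k) * in_y (monom 1 (j - Suc k)))"

lemma in_y_monom: "in_y (monom 1 j) = monom 1 j"
  by (simp add: in_y_def map_poly_monom)

lemma degree_in_y: "degree (in_y b) = degree b"
  by (simp add: in_y_def degree_map_poly)

lemma lead_coeff_in_y: "lead_coeff (in_y b) = [:lead_coeff b:]"
  by (simp add: degree_in_y) (simp add: in_y_def coeff_map_poly)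

text \<open>The pair of the degree in \<open>y\<close> and the leading coefficient in \<open>\<real>[x]\<close> determines the cell. The degree
separates the two sides of the staircase: it is less than \<open>m\<close> on one and at least
\<open>degree b\<close> on the other.\<close>

lemma inj_on_stair_poly:
  assumes "a \<noteq> 0" "b \<noteq> 0" "m \<le> degree b"
  shows "inj_on (stair_poly a b m) (set (cells m))"
proof (rule inj_onI)
  let ?t = "stair_poly a b m"
  have low: "degree (?t (k, j)) = j" "lead_coeff (?t (k, j)) = a * monom 1 (m - Suc k)"
    if "j \<le> k" for k j
  proof -
    have t: "?t (k, j) = monom (a * monom 1 (m - Suc k)) j"
      using that by (simp add: stair_poly_def in_x_def in_y_monom smult_monom)
    show "degree (?t (k, j)) = j"
      unfolding t using assms(1) by (intro degree_monom_eq) simp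
    show "lead_coeff (?t (k, j)) = a * monom 1 (m - Suc k)"
      unfolding t by (rule lead_coeff_monom)
  qed
  have high: "degree (?t (k, j)) = degree b + (j - Suc k)"
      "lead_coeff (?t (k, j)) = smult (lead_coeff b) (monom 1 k)"
    if "\<not> j \<le> k" for k j
  proof -
    have t: "?t (k, j) = in_y b * (in_x (monom 1 k) * monom 1 (j - Suc k))"
      using that by (simp add: stair_poly_def in_y_monom mult.assoc)
    have b: "in_y b \<noteq> 0"
      using lead_coeff_in_y[of b] assms(2) by (metis leading_coeff_0_iff pCons_eq_0_iff)
    have "degree (?t (k, j)) = degree (in_y b * monom (monom 1 k) (j - Suc k))"
      unfolding t by (simp add: in_x_def smult_monom)
    also have "\<dots> = degree (in_y b) + degree (monom (monom 1 k :: real poly) (j - Suc k))"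
      using b by (intro degree_mult_eq) simp_all
    also have "degree (monom (monom 1 k :: real poly) (j - Suc k)) = j - Suc k"
      by (rule degree_monom_eq) simp
    finally show "degree (?t (k, j)) = degree b + (j - Suc k)"
      by (simp only: degree_in_y)
    show "lead_coeff (?t (k, j)) = smult (lead_coeff b) (monom 1 k)"
      unfolding t lead_coeff_mult lead_coeff_in_y lead_coeff_monom by (simp add: in_x_def)
  qed
  fix p q assume "p \<in> set (cells m)" "q \<in> set (cells m)" and eq: "?t p = ?t q"
  then obtain k j k' j' where pq: "p = (k, j)" "q = (k', j')" "k < m" "k' < m" by auto
  have deg: "degree (?t (k, j)) = degree (?t (k', j'))"
    and lc: "lead_coeff (?t (k, j)) = lead_coeff (?t (k', j'))"
    using eq pq by auto
  show "p = q"
  proof (cases "j \<le> k"; cases "j' \<le> k'")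
    assume "j \<le> k" "j' \<le> k'"
    note low = low[OF this(1)] low[OF this(2)]
    have "a * monom 1 (m - Suc k) = a * monom 1 (m - Suc k')"
      by (rule trans[OF trans[OF low(2)[symmetric] lc] low(4)])
    then have "monom (1 :: real) (m - Suc k) = monom 1 (m - Suc k')"
      using assms(1) by simp
    then have "m - Suc k = m - Suc k'" by (simp add: monom_eq_iff')
    then show ?thesis using deg pq unfolding low by auto
  next
    assume "\<not> j \<le> k" "\<not> j' \<le> k'"
    note nlow = this and high = high[OF this(1)] high[OF this(2)]
    have "smult (lead_coeff b) (monom 1 k) = smult (lead_coeff b) (monom 1 k')"
      by (rule trans[OF trans[OF high(2)[symmetric] lc] high(4)])
    then have "k = k'" using assms(2) by (simp add: smult_monom monom_eq_iff')
    then show ?thesis using deg pq nlow unfolding high by auto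
  qed (use deg pq assms(3) in \<open>auto simp: low high\<close>)
qed

lemma image_stair_poly:
  assumes "m = n div 2" "m > 0"
  shows "stair_poly a b m ` set (cells m) = even_polys n a b"
proof (intro equalityI subsetI)
  fix t assume "t \<in> stair_poly a b m ` set (cells m)"
  then obtain k j where "t = stair_poly a b m (k, j)" "k < m" "j \<le> m" by auto
  then consider
      "t = in_x a * in_x (monom 1 (m - Suc k)) * in_y (monom 1 j)" "m - Suc k + j \<le> m - 1"
    | "t = in_y b * in_x (monom 1 k) * in_y (monom 1 (j - Suc k))" "k + (j - Suc k) \<le> m - 1"
    by (cases "j \<le> k") (simp_all add: stair_poly_def)
  then show "t \<in> even_polys n a b"
    unfolding even_polys_def assms(1)[symmetric] by cases blast+
next
  fix t assume "t \<in> even_polys n a b"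
  then consider
      (a) \<alpha> \<beta> where "t = in_x a * in_x (monom 1 \<alpha>) * in_y (monom 1 \<beta>)" "\<alpha> + \<beta> \<le> m - 1"
    | (b) \<alpha> \<beta> where "t = in_y b * in_x (monom 1 \<alpha>) * in_y (monom 1 \<beta>)" "\<alpha> + \<beta> \<le> m - 1"
    unfolding even_polys_def assms(1) by blast
  then show "t \<in> stair_poly a b m ` set (cells m)"
  proof cases
    case a
    then have "t = stair_poly a b m (m - Suc \<alpha>, \<beta>)" "(m - Suc \<alpha>, \<beta>) \<in> set (cells m)"
      using assms(2) by (auto simp: stair_poly_def Suc_diff_Suc)
    then show ?thesis by blast
  next
    case b
    then have "t = stair_poly a b m (\<alpha>, Suc (\<alpha> + \<beta>))" "(\<alpha>, Suc (\<alpha> + \<beta>)) \<in> set (cells m)"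
      using assms(2) by (auto simp: stair_poly_def)
    then show ?thesis by blast
  qed
qed

lemma mset_permutation_of_image:
  assumes "zs \<in> permutations_of_set (h ` set is)" "inj_on h (set is)" "distinct is"
  shows "mset zs = mset (map h is)"
  using permutations_of_setD[OF assms(1)] assms(2,3)
  by (subst set_eq_iff_mset_eq_distinct[symmetric]) (auto simp: distinct_map)

text \<open>Reversing the order of the entries that contain \<open>a\<close> turns a column of \<open>P\<close> into one of the families
of the staircase array; as a multiset it is unchanged.\<close>

lemma mset_P_column:
  assumes "ps \<in> entry_orderings (col (P_mat n a) j)" "m = n div 2" "j \<le> m"
  shows "mset ps = mset (map (\<lambda>k. if j \<le> k then monom 1 (m - Suc k) * a else monom 1 k) [0..<m])"
proof -
  let ?p = "\<lambda>k. if j \<le> k then monom 1 (m - Suc k) * a else monom 1 k"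
  \<comment> \<open>The reversal of \<open>{j..<m}\<close>, extended by the identity.\<close>
  define \<sigma> where "\<sigma> k = (if j \<le> k then m - Suc k + j else k)" for k
  have \<sigma>: "inj_on \<sigma> {0..<m}" "\<sigma> ` {0..<m} = {0..<m}"
  proof -
    show inj: "inj_on \<sigma> {0..<m}"
      by (auto simp: inj_on_def \<sigma>_def split: if_splits)
    have "\<sigma> ` {0..<m} \<subseteq> {0..<m}" by (auto simp: \<sigma>_def)
    then show "\<sigma> ` {0..<m} = {0..<m}"
      using inj by (intro endo_inj_surj) auto
  qed
  have "mset ps = mset (map (\<lambda>i. P_entry a (i + 1) (j + 1)) [0..<m])"
  proof -
    have "list_of_vec (col (P_mat n a) j) = map (\<lambda>i. P_entry a (i + 1) (j + 1)) [0..<m]"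
      using assms(2,3) by (intro nth_equalityI) (auto simp: P_mat_def list_of_vec_index)
    then show ?thesis
      using assms(1) by (simp add: entry_orderings_def permutations_of_multiset_def)
  qed
  also have "map (\<lambda>i. P_entry a (i + 1) (j + 1)) [0..<m] = map (?p \<circ> \<sigma>) [0..<m]"
    by (intro map_cong) (auto simp: P_entry_def \<sigma>_def)
  also have "mset \<dots> = image_mset ?p (image_mset \<sigma> (mset_set {0..<m}))"
    by (simp add: multiset.map_comp)
  also have "image_mset \<sigma> (mset_set {0..<m}) = mset_set {0..<m}"
    using \<sigma> by (simp add: image_mset_mset_set)
  finally show ?thesis by simp
qed

lemma mset_Q_row:
  assumes "qs \<in> entry_orderings (row (Q_mat n b) i)" "m = n div 2" "i < m"
  shows "mset qs = mset (map (\<lambda>j. if j \<le> i then monom 1 j else monom 1 (j - Suc i) * b) [0..<Suc m])"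
proof -
  have "list_of_vec (row (Q_mat n b) i) = map (\<lambda>j. Q_entry b (i + 1) (j + 1)) [0..<Suc m]"
    using assms(2,3) by (intro nth_equalityI) (auto simp: Q_mat_def list_of_vec_index simp del: upt_Suc)
  also have "\<dots> = map (\<lambda>j. if j \<le> i then monom 1 j else monom 1 (j - Suc i) * b) [0..<Suc m]"
    by (intro map_cong) (auto simp: Q_entry_def)
  finally show ?thesis
    using assms(1) by (simp add: entry_orderings_def permutations_of_multiset_def del: upt_Suc)
qed

theorem corollary1:
  fixes n :: nat and x y :: "nat \<Rightarrow> real" and a b :: "real poly"
    and as :: "(real \<times> real) list" and fs :: "bipoly list"
    and xs ys :: "nat \<Rightarrow> real list" and ps qs :: "nat \<Rightarrow> real poly list"
  assumes "n \<ge> 2" and "even n"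
    and "inj_on x {1..n + 1}" and "inj_on y {1..n + 2}"
    and "a = odd_annihilator n x" and "b = odd_annihilator n y"
    and "as \<in> permutations_of_set (even_grid n x y)"
    and "fs \<in> permutations_of_set (even_polys n a b)"
    and "\<And>j. j < n div 2 + 1 \<Longrightarrow> xs j \<in> permutations_of_set {x (2 * i) | i. 1 \<le> i \<and> i \<le> n div 2}"
    and "\<And>j. j < n div 2 + 1 \<Longrightarrow> ps j \<in> entry_orderings (col (P_mat n a) j)"
    and "\<And>i. i < n div 2 \<Longrightarrow> ys i \<in> permutations_of_set {y (2 * j) | j. 1 \<le> j \<and> j \<le> n div 2 + 1}"
    and "\<And>i. i < n div 2 \<Longrightarrow> qs i \<in> entry_orderings (row (Q_mat n b) i)"
  shows "\<bar>vdm2 as fs\<bar> =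
    \<bar>(\<Prod>j < n div 2 + 1. vdm (xs j) (ps j)) * (\<Prod>i < n div 2. vdm (ys i) (qs i))\<bar>"
proof -
  define m where "m = n div 2"
  have m: "m > 0" "n = 2 * m" using assms(1,2) by (auto simp: m_def)
  define X Y where "X r = x (2 * Suc r)" and "Y s = y (2 * Suc s)" for r s
  let ?u = "\<lambda>k r. X r ^ k" and ?w = "\<lambda>k r. X r ^ (m - Suc k) * poly a (X r)"
  let ?f = "\<lambda>j s. Y s ^ j" and ?g = "\<lambda>j s. Y s ^ j * poly b (Y s)"
  have injX: "inj_on X (set [0..<m])"
  proof (rule inj_onI)
    fix r r' assume "r \<in> set [0..<m]" "r' \<in> set [0..<m]" "X r = X r'"
    then show "r = r'" using inj_onD[OF assms(3), of "2 * Suc r" "2 * Suc r'"] m(2) by (auto simp: X_def)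
  qed
  have injY: "inj_on Y (set [0..<Suc m])"
  proof (rule inj_onI)
    fix s s' assume "s \<in> set [0..<Suc m]" "s' \<in> set [0..<Suc m]" "Y s = Y s'"
    then show "s = s'" using inj_onD[OF assms(4), of "2 * Suc s" "2 * Suc s'"] m(2) by (auto simp: Y_def)
  qed
  have even_nodes: "{z (2 * i) | i. 1 \<le> i \<and> i \<le> N} = (\<lambda>i. z (2 * Suc i)) ` set [0..<N]"
    for z :: "nat \<Rightarrow> real" and N
  proof -
    have "{1..N} = Suc ` set [0..<N]" by (simp add: image_Suc_atLeastLessThan atLeastLessThanSuc_atLeastAtMost)
    then have "(\<lambda>i. z (2 * i)) ` {1..N} = (\<lambda>i. z (2 * Suc i)) ` set [0..<N]"
      by (simp only: image_image)
    moreover have "{z (2 * i) | i. 1 \<le> i \<and> i \<le> N} = (\<lambda>i. z (2 * i)) ` {1..N}" by auto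
    ultimately show ?thesis by simp
  qed
  have X_nodes: "{x (2 * i) | i. 1 \<le> i \<and> i \<le> n div 2} = X ` set [0..<m]"
    unfolding even_nodes X_def m_def ..
  have Y_nodes: "{y (2 * j) | j. 1 \<le> j \<and> j \<le> n div 2 + 1} = Y ` set [0..<Suc m]"
    unfolding even_nodes Y_def m_def by simp
  let ?XY = "\<lambda>(r, s). (X r, Y s)"
  have "even_grid n x y
      = {x (2 * i) | i. 1 \<le> i \<and> i \<le> n div 2} \<times> {y (2 * j) | j. 1 \<le> j \<and> j \<le> n div 2 + 1}"
    unfolding even_grid_def by blast
  also have "\<dots> = ?XY ` set (cells m)"
    unfolding X_nodes Y_nodes by force
  finally have grid: "even_grid n x y = ?XY ` set (cells m)" .
  have "inj_on ?XY (set (cells m))"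
    using injX injY by (auto simp: inj_on_def simp del: upt_Suc)
  then have as: "mset as = mset (map ?XY (cells m))"
    using assms(7) unfolding grid
    by (intro mset_permutation_of_image) (auto simp: distinct_product simp del: upt_Suc)
  have "a \<noteq> 0" "b \<noteq> 0" "m \<le> degree b"
    using assms(5,6) by (simp_all add: m_def odd_annihilator_nonzero degree_odd_annihilator)
  then have fs: "mset fs = mset (map (stair_poly a b m) (cells m))"
    using assms(8) unfolding image_stair_poly[OF m_def m(1), symmetric]
    by (intro mset_permutation_of_image inj_on_stair_poly) (auto simp: distinct_product simp del: upt_Suc)
  have "\<bar>vdm2 as fs\<bar> = \<bar>vdm_wrt bieval (map ?XY (cells m)) (map (stair_poly a b m) (cells m))\<bar>"
    unfolding vdm2_def by (rule abs_vdm_wrt_mset_cong[OF as fs]) simp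
  also have "vdm_wrt bieval (map ?XY (cells m)) (map (stair_poly a b m) (cells m))
      = vdm_wrt (stair ?u ?w ?f ?g) (cells m) (cells m)"
    unfolding vdm_wrt_map
    by (rule vdm_wrt_cong_set)
       (auto simp: stair_def stair_col_def stair_row_def stair_poly_def
         bieval_mult bieval_in_x bieval_in_y poly_monom simp del: upt_Suc)
  also have "\<bar>\<dots>\<bar> = (\<Prod>j<Suc m. \<bar>vdm_wrt (stair_col ?u ?w j) [0..<m] [0..<m]\<bar>)
      * (\<Prod>k<m. \<bar>vdm_wrt (stair_row ?f ?g k) [0..<Suc m] [0..<Suc m]\<bar>)"
    by (rule abs_vdm_wrt_stair)
  also have "(\<Prod>j<Suc m. \<bar>vdm_wrt (stair_col ?u ?w j) [0..<m] [0..<m]\<bar>)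
      = (\<Prod>j<Suc m. \<bar>vdm (xs j) (ps j)\<bar>)"
  proof (intro prod.cong refl)
    fix j assume "j \<in> {..<Suc m}"
    then have j: "j < n div 2 + 1" "j \<le> m" by (auto simp: m_def)
    let ?p = "\<lambda>k. if j \<le> k then monom 1 (m - Suc k) * a else monom 1 k"
    have "mset (xs j) = mset (map X [0..<m])"
      using assms(9)[OF j(1)] injX unfolding X_nodes by (intro mset_permutation_of_image) auto
    moreover have "mset (ps j) = mset (map ?p [0..<m])"
      using assms(10)[OF j(1)] m_def j(2) by (rule mset_P_column)
    ultimately have "\<bar>vdm (xs j) (ps j)\<bar> = \<bar>vdm_wrt poly (map X [0..<m]) (map ?p [0..<m])\<bar>"
      unfolding vdm_def by (rule abs_vdm_wrt_mset_cong) simp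
    also have "vdm_wrt poly (map X [0..<m]) (map ?p [0..<m])
        = vdm_wrt (stair_col ?u ?w j) [0..<m] [0..<m]"
      unfolding vdm_wrt_map
      by (rule vdm_wrt_cong_set) (auto simp: stair_col_def poly_monom)
    finally show "\<bar>vdm_wrt (stair_col ?u ?w j) [0..<m] [0..<m]\<bar> = \<bar>vdm (xs j) (ps j)\<bar>" ..
  qed
  also have "(\<Prod>k<m. \<bar>vdm_wrt (stair_row ?f ?g k) [0..<Suc m] [0..<Suc m]\<bar>)
      = (\<Prod>k<m. \<bar>vdm (ys k) (qs k)\<bar>)"
  proof (intro prod.cong refl)
    fix k assume "k \<in> {..<m}"
    then have k: "k < n div 2" "k < m" by (auto simp: m_def)
    let ?q = "\<lambda>j. if j \<le> k then monom 1 j else monom 1 (j - Suc k) * b"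
    have "mset (ys k) = mset (map Y [0..<Suc m])"
      using assms(11)[OF k(1)] injY unfolding Y_nodes by (intro mset_permutation_of_image) auto
    moreover have "mset (qs k) = mset (map ?q [0..<Suc m])"
      using assms(12)[OF k(1)] m_def k(2) by (rule mset_Q_row)
    ultimately have "\<bar>vdm (ys k) (qs k)\<bar> = \<bar>vdm_wrt poly (map Y [0..<Suc m]) (map ?q [0..<Suc m])\<bar>"
      unfolding vdm_def by (rule abs_vdm_wrt_mset_cong) simp
    also have "vdm_wrt poly (map Y [0..<Suc m]) (map ?q [0..<Suc m])
        = vdm_wrt (stair_row ?f ?g k) [0..<Suc m] [0..<Suc m]"
      unfolding vdm_wrt_map
      by (rule vdm_wrt_cong_set) (auto simp: stair_row_def poly_monom)
    finally show "\<bar>vdm_wrt (stair_row ?f ?g k) [0..<Suc m] [0..<Suc m]\<bar> = \<bar>vdm (ys k) (qs k)\<bar>" ..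
  qed
  finally show ?thesis
    by (simp only: abs_mult abs_prod m_def Suc_eq_plus1)
qed

end
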